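(* Let $p,q\in\mathbb{C}$ and let $n\ge 1$ be a fixed integer. Let $X(m)$ be a product of $n$ functions, each of which satisfies the recurrence with parameters $p,q$; that is, $X(m)=\prod_{j=1}^{n}x^{(j)}_m$ for $m\ge 0$, where each $(x^{(j)}_m)_{m\ge 0}$ is a sequence of complex numbers with arbitrary initial values $x^{(j)}_0,x^{(j)}_1\in\mathbb{C}$ satisfying $x^{(j)}_r=p\,x^{(j)}_{r-1}-q\,x^{(j)}_{r-2}$ for all $r\ge 2$. Then $X(m)$ satisfies the recurrence $$\sum_{i=0}^{n+1}(-1)^i\,q^{i(i-1)/2}\,(n+1|i)_u\,X(m-i)=0\qquad\text{for all } m\ge n+1.$$
   Context: Generalised binomial coefficients $(r|k)_u$: let $p,q\in\mathbb{C}$ and let $\sigma,\tau\in\mathbb{C}$ be the roots (with multiplicity) of $x^2-px+q=0$. For $r\ge 1$ let $f_r(x,y)=\sum_{i=0}^{r-1}x^{r-1-i}y^i=(x^r-y^r)/(x-y)\in\mathbb{Z}[x,y]$. For $1\le k\le r$ the quotient $$F(r,k,x,y)=\frac{f_rf_{r-1}\cdots f_{r-k+1}}{f_kf_{k-1}\cdots f_1}$$ is a polynomial in $\mathbb{Z}[x,y]$. Define $(r|k)_u=F(r,k,\sigma,\tau)$ for $1\le k\le r$, and $(r|0)_u=1$. (The subscript $u$ refers to the sequence $u_0=0$, $u_1=1$, $u_r=pu_{r-1}-qu_{r-2}$, for which $u_r=f_r(\sigma,\tau)$ for $r\ge1$; no assumption is made that the $u_r$ are nonzero.) Convention: $q^0=1$,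 also when $q=0$. *)

theory Defs
  imports Complex_Main "HOL-Computational_Algebra.Polynomial"
begin

text \<open>
  Elements of \<open>\<int>[x, y]\<close> are represented as polynomials in \<open>x\<close> whose coefficients are
  polynomials in \<open>y\<close> over the integers.
\<close>

definition var_x :: "int poly poly" where
  "var_x = [:0, 1:]"

definition var_y :: "int poly poly" where
  "var_y = [:[:0, 1:]:]"

definition eval2 :: "int poly poly \<Rightarrow> complex \<Rightarrow> complex \<Rightarrow> complex" where
  "eval2 P a b = poly (map_poly (\<lambda>c. poly (map_poly of_int c) b) P) a"

definition f_poly :: "nat \<Rightarrow> int poly poly" where
  "f_poly r = (\<Sum>i<r. var_x ^ (r - 1 - i) * var_y ^ i)"

definition F_numer :: "nat \<Rightarrow> nat \<Rightarrow> int poly poly" where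
  "F_numer r k = (\<Prod>i<k. f_poly (r - i))"

definition F_denom :: "nat \<Rightarrow> int poly poly" where
  "F_denom k = (\<Prod>i=1..k. f_poly i)"

text \<open>
  On \<^typ>\<open>int poly poly\<close> the operation \<open>div\<close> is exact division, meaningful only when the
  denominator divides the numerator; see \<open>F_poly_mult_denom\<close> below.
\<close>

definition F_poly :: "nat \<Rightarrow> nat \<Rightarrow> int poly poly" where
  "F_poly r k = F_numer r k div F_denom k"

text \<open>
  The coefficient \<open>(r|k)\<^sub>u\<close>, as a function of the two roots \<open>\<sigma>\<close>, \<open>\<tau>\<close> of \<open>x\<^sup>2 - p x + q\<close>.
  Only \<open>k \<le> r\<close> is of interest; for \<open>k > r\<close> the value is \<open>0\<close>, since \<open>F_numer r k\<close> then
  has the factor \<open>f_poly 0 = 0\<close>.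
\<close>

definition gen_binomial :: "complex \<Rightarrow> complex \<Rightarrow> nat \<Rightarrow> nat \<Rightarrow> complex" where
  "gen_binomial \<sigma> \<tau> r k = (if k = 0 then 1 else eval2 (F_poly r k) \<sigma> \<tau>)"

definition satisfies_recurrence :: "complex \<Rightarrow> complex \<Rightarrow> (nat \<Rightarrow> complex) \<Rightarrow> bool" where
  "satisfies_recurrence p q x \<longleftrightarrow> (\<forall>r\<ge>2. x r = p * x (r - 1) - q * x (r - 2))"


lemma f_poly_Suc: "f_poly (Suc r) = var_x * f_poly r + var_y ^ r"
proof -
  have "(\<Sum>i<r. var_x ^ (r - i) * var_y ^ i)
      = (\<Sum>i<r. var_x * (var_x ^ (r - 1 - i) * var_y ^ i))"
  proof (rule sum.cong [OF refl])
    fix i assume "i \<in> {..<r}"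
    then have "r - i = Suc (r - 1 - i)" by auto
    then show "var_x ^ (r - i) * var_y ^ i = var_x * (var_x ^ (r - 1 - i) * var_y ^ i)"
      by (metis power_Suc mult.assoc)
  qed
  then show ?thesis
    by (simp add: f_poly_def sum_distrib_left)
qed

lemma f_poly_add: "f_poly (a + b) = var_x ^ b * f_poly a + var_y ^ a * f_poly b"
proof (induction b)
  case 0
  show ?case by (simp add: f_poly_def)
next
  case (Suc b)
  then show ?case
    by (simp add: f_poly_Suc algebra_simps power_add)
qed

lemma f_poly_nonzero: "r \<ge> 1 \<Longrightarrow> f_poly r \<noteq> 0"
proof -
  assume "r \<ge> 1"
  then obtain s where r: "r = Suc s" by (cases r) auto
  have "poly (f_poly r) 0 = [:0, 1:] ^ s"
    by (simp add: r f_poly_Suc var_x_def var_y_def poly_power)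
  then show ?thesis by auto
qed

lemma F_denom_nonzero: "F_denom k \<noteq> 0"
  by (auto simp: F_denom_def f_poly_nonzero)

lemma F_denom_dvd_F_numer: "F_denom k dvd F_numer r k"
proof (induction r arbitrary: k)
  case 0
  show ?case
    by (cases k) (auto simp: F_denom_def F_numer_def f_poly_def)
next
  case (Suc r)
  show ?case
  proof (cases k)
    case 0
    then show ?thesis by (simp add: F_denom_def)
  next
    case (Suc j)
    have num: "F_numer (Suc r) (Suc j) = f_poly (Suc r) * F_numer r j"
      unfolding F_numer_def prod.lessThan_Suc_shift by simp
    have num': "F_numer r (Suc j) = F_numer r j * f_poly (r - j)"
      by (simp add: F_numer_def)
    have den: "F_denom (Suc j) = F_denom j * f_poly (Suc j)"
      by (simp add: F_denom_def)
    show ?thesis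
    proof (cases "j \<le> r")
      case True
      then have "f_poly (Suc r) = f_poly ((r - j) + Suc j)" by simp
      then have "F_numer (Suc r) (Suc j)
          = var_x ^ Suc j * F_numer r (Suc j) + var_y ^ (r - j) * (F_numer r j * f_poly (Suc j))"
        unfolding num num' f_poly_add by (simp only: algebra_simps)
      moreover have "F_denom (Suc j) dvd F_numer r (Suc j)" by (rule Suc.IH)
      moreover have "F_denom (Suc j) dvd F_numer r j * f_poly (Suc j)"
        unfolding den by (intro mult_dvd_mono Suc.IH dvd_refl)
      ultimately show ?thesis unfolding Suc by (metis dvd_add dvd_mult)
    next
      case False
      then have "F_numer r j = 0"
        unfolding F_numer_def by (intro prod_zero) (auto simp: f_poly_def intro!: bexI [of _ r])
      then show ?thesis unfolding Suc num by simp
    qed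
  qed
qed

lemma F_poly_mult_denom: "F_poly r k * F_denom k = F_numer r k"
  using F_denom_dvd_F_numer by (simp add: F_poly_def)

end

theory Submission
  imports Defs
begin

text \<open>
  Write \<open>E\<close> for the backward shift \<open>(E Y) m = Y (m - 1)\<close>. By the \<open>q\<close>-binomial theorem the operator
  in the claim, with \<open>N = n + 1\<close>, is \<open>L\<^sub>N(E) = (\<Prod>j<N. (1 - \<sigma>\<^sup>j \<tau>\<^sup>N\<^sup>-\<^sup>1\<^sup>-\<^sup>j E))\<close>, so when \<open>\<sigma> \<noteq> \<tau>\<close> and
  \<open>q \<noteq> 0\<close> it kills every product of \<open>n\<close> combinations of the powers \<open>\<sigma>\<^sup>m\<close> and \<open>\<tau>\<^sup>m\<close>.
  The proof below never divides by \<open>\<sigma> - \<tau>\<close> or \<open>q\<close> and therefore also covers \<open>\<sigma> = \<tau>\<close> and \<open>q = 0\<close>. It is an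
  induction on the number of factors that rests on three facts.

  First, peeling off one factor of the product gives \<open>L\<^bsub>N+1\<^esub>(E) = (1 - \<sigma>\<^sup>N E) L\<^sub>N(\<tau> E)\<close>; in terms of
  coefficients this is the Pascal rule for \<open>(r|k)\<^sub>u\<close> (\<open>gen_binomial_Pascal\<close>,
  \<open>shift_op_Suc\<close>). Second, a solution \<open>z\<close> of the recurrence satisfies
  \<open>z m = \<tau>\<^sup>i z (m - i) + d \<sigma>\<^sup>m\<^sup>-\<^sup>i u\<^sub>i\<close> with \<open>d = z 1 - \<tau> z 0\<close> (\<open>recurrence_expand\<close>).
  Third, \<open>u\<^sub>i (N|i)\<^sub>u = u\<^sub>N (N-1|i-1)\<^sub>u\<close> (\<open>gen_binomial_absorb\<close>).

  Let \<open>L\<^sub>N(E) Y = 0\<close>. Replacing \<open>\<tau>\<^sup>i z (m - i)\<close> by \<open>z m - d \<sigma>\<^sup>m\<^sup>-\<^sup>i u\<^sub>i\<close> in \<open>L\<^sub>N(\<tau> E) (z Y)\<close> leaves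
  \<open>z m\<close> times \<open>L\<^sub>N(E) Y = 0\<close>, and a remainder which by the third fact equals
  \<open>d u\<^sub>N \<sigma>\<^sup>m\<^sup>-\<^sup>1 (L\<^bsub>N-1\<^esub>(\<tau> E) Y) (m - 1)\<close> (\<open>twisted_op_mult\<close>). Applying \<open>1 - \<sigma>\<^sup>N E\<close> to that
  remainder gives \<open>d u\<^sub>N \<sigma>\<^sup>m\<^sup>-\<^sup>1\<close> times \<open>((1 - \<sigma>\<^sup>N\<^sup>-\<^sup>1 E) L\<^bsub>N-1\<^esub>(\<tau> E) Y) (m - 1) = (L\<^sub>N(E) Y) (m - 1) = 0\<close>.
\<close>

section \<open>Evaluation of integer polynomials in two variables\<close>

lemma map_poly_mult_hom:
  fixes f :: "'a::comm_semiring_0 \<Rightarrow> 'b::comm_semiring_0"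
  assumes "f 0 = 0" "\<And>a b. f (a + b) = f a + f b" "\<And>a b. f (a * b) = f a * f b"
  shows "map_poly f (P * Q) = map_poly f P * map_poly f Q"
proof (rule poly_eqI)
  fix n
  have sum_hom: "f (\<Sum>i\<in>A. g i) = (\<Sum>i\<in>A. f (g i))" for A :: "nat set" and g
    by (induction A rule: infinite_finite_induct) (simp_all add: assms)
  show "coeff (map_poly f (P * Q)) n = coeff (map_poly f P * map_poly f Q) n"
    by (simp add: coeff_map_poly coeff_mult assms sum_hom)
qed

lemma map_poly_add_hom:
  fixes f :: "'a::comm_monoid_add \<Rightarrow> 'b::comm_monoid_add"
  assumes "f 0 = 0" "\<And>a b. f (a + b) = f a + f b"
  shows "map_poly f (P + Q) = map_poly f P + map_poly f Q"
  by (rule poly_eqI) (simp add: coeff_map_poly assms)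

lemma eval2_add: "eval2 (P + Q) a b = eval2 P a b + eval2 Q a b"
  unfolding eval2_def by (subst map_poly_add_hom) (simp_all add: map_poly_add_hom)

lemma eval2_mult: "eval2 (P * Q) a b = eval2 P a b * eval2 Q a b"
  unfolding eval2_def
  by (subst map_poly_mult_hom) (simp_all add: map_poly_add_hom map_poly_mult_hom)

lemma eval2_1: "eval2 1 a b = 1"
  by (simp add: eval2_def one_pCons map_poly_pCons)

lemma eval2_power: "eval2 (P ^ k) a b = eval2 P a b ^ k"
  by (induction k) (simp_all add: eval2_1 eval2_mult)

lemma eval2_var_x: "eval2 var_x a b = a"
  by (simp add: eval2_def var_x_def map_poly_pCons)

lemma eval2_var_y: "eval2 var_y a b = b"
  by (simp add: eval2_def var_y_def map_poly_pCons)

lemmas eval2_simps = eval2_add eval2_mult eval2_power eval2_var_x eval2_var_y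


section \<open>Identities for the generalised binomial coefficients\<close>

lemma F_numer_Suc_Suc: "F_numer (Suc r) (Suc k) = f_poly (Suc r) * F_numer r k"
  unfolding F_numer_def prod.lessThan_Suc_shift by simp

lemma F_denom_Suc: "F_denom (Suc k) = F_denom k * f_poly (Suc k)"
  by (simp add: F_denom_def)

lemma F_poly_absorb: "f_poly (Suc k) * F_poly (Suc r) (Suc k) = f_poly (Suc r) * F_poly r k"
proof -
  have "f_poly (Suc k) * F_poly (Suc r) (Suc k) * F_denom k = F_numer (Suc r) (Suc k)"
    by (simp add: F_poly_mult_denom [symmetric] F_denom_Suc mult_ac)
  also have "\<dots> = f_poly (Suc r) * F_poly r k * F_denom k"
    by (simp add: F_numer_Suc_Suc F_poly_mult_denom mult.assoc)
  finally show ?thesis by (simp add: F_denom_nonzero)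
qed

text \<open>
  After multiplication by the common denominator this is the splitting
  \<open>f\<^bsub>r+1\<^esub> = x\<^sup>r\<^sup>-\<^sup>k f\<^bsub>k+1\<^esub> + y\<^sup>k\<^sup>+\<^sup>1 f\<^bsub>r-k\<^esub>\<close> of the leading factor of the numerator.
\<close>

lemma F_poly_Pascal:
  assumes "k \<le> r"
  shows "F_poly (Suc r) (Suc k) = var_x ^ (r - k) * F_poly r k + var_y ^ Suc k * F_poly r (Suc k)"
proof -
  have num: "F_numer r (Suc k) = F_numer r k * f_poly (r - k)"
    by (simp add: F_numer_def)
  have split: "f_poly (Suc r) = var_x ^ (r - k) * f_poly (Suc k) + var_y ^ Suc k * f_poly (r - k)"
    using f_poly_add [of "Suc k" "r - k"] assms by simp
  have "F_poly (Suc r) (Suc k) * F_denom (Suc k) = f_poly (Suc r) * F_numer r k"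
    by (simp only: F_poly_mult_denom F_numer_Suc_Suc)
  also have "\<dots> = var_x ^ (r - k) * (F_numer r k * f_poly (Suc k)) + var_y ^ Suc k * F_numer r (Suc k)"
    unfolding split num by (simp only: algebra_simps)
  also have "\<dots> = (var_x ^ (r - k) * F_poly r k + var_y ^ Suc k * F_poly r (Suc k)) * F_denom (Suc k)"
    unfolding F_poly_mult_denom [symmetric] F_denom_Suc by (simp only: algebra_simps)
  finally show ?thesis by (simp add: F_denom_nonzero)
qed

lemma gen_binomial_0 [simp]: "gen_binomial \<sigma> \<tau> r 0 = 1"
  by (simp add: gen_binomial_def)

lemma gen_binomial_eq_eval2: "gen_binomial \<sigma> \<tau> r k = eval2 (F_poly r k) \<sigma> \<tau>"
  by (simp add: gen_binomial_def F_poly_def F_numer_def F_denom_def eval2_1)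

lemma gen_binomial_eq_0:
  assumes "r < k"
  shows "gen_binomial \<sigma> \<tau> r k = 0"
proof -
  have "F_numer r k = 0"
    unfolding F_numer_def using assms
    by (intro prod_zero) (auto simp: f_poly_def intro!: bexI [of _ r])
  then show ?thesis
    by (simp add: gen_binomial_eq_eval2 F_poly_def eval2_def)
qed

lemma gen_binomial_Pascal:
  "k \<le> r \<Longrightarrow> gen_binomial \<sigma> \<tau> (Suc r) (Suc k)
     = \<sigma> ^ (r - k) * gen_binomial \<sigma> \<tau> r k + \<tau> ^ Suc k * gen_binomial \<sigma> \<tau> r (Suc k)"
  by (simp only: gen_binomial_eq_eval2 F_poly_Pascal eval2_simps)

text \<open>The Lucas sequence \<open>u\<^sub>0 = 0\<close>, \<open>u\<^sub>1 = 1\<close>, \<open>u\<^sub>r = (\<sigma> + \<tau>) u\<^bsub>r-1\<^esub> - \<sigma> \<tau> u\<^bsub>r-2\<^esub>\<close>.\<close>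

definition lucas_u :: "complex \<Rightarrow> complex \<Rightarrow> nat \<Rightarrow> complex" where
  "lucas_u \<sigma> \<tau> r = eval2 (f_poly r) \<sigma> \<tau>"

lemma lucas_u_0 [simp]: "lucas_u \<sigma> \<tau> 0 = 0"
  by (simp add: lucas_u_def f_poly_def eval2_def)

lemma lucas_u_Suc: "lucas_u \<sigma> \<tau> (Suc r) = \<sigma> * lucas_u \<sigma> \<tau> r + \<tau> ^ r"
  by (simp add: lucas_u_def f_poly_Suc eval2_simps)

lemma gen_binomial_absorb:
  "lucas_u \<sigma> \<tau> (Suc k) * gen_binomial \<sigma> \<tau> (Suc r) (Suc k)
     = lucas_u \<sigma> \<tau> (Suc r) * gen_binomial \<sigma> \<tau> r k"
  unfolding lucas_u_def gen_binomial_eq_eval2 eval2_mult [symmetric] F_poly_absorb ..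


section \<open>The recurrence operators\<close>

definition rec_coeff :: "complex \<Rightarrow> complex \<Rightarrow> nat \<Rightarrow> nat \<Rightarrow> complex" where
  "rec_coeff \<sigma> \<tau> N i = (- 1) ^ i * (\<sigma> * \<tau>) ^ (i * (i - 1) div 2) * gen_binomial \<sigma> \<tau> N i"

definition shift_op :: "complex \<Rightarrow> complex \<Rightarrow> nat \<Rightarrow> (nat \<Rightarrow> complex) \<Rightarrow> nat \<Rightarrow> complex" where
  "shift_op \<sigma> \<tau> N Y m = (\<Sum>i\<le>N. rec_coeff \<sigma> \<tau> N i * Y (m - i))"

text \<open>With \<open>shift_op\<close> read as \<open>L\<^sub>N(E)\<close>, this is \<open>L\<^sub>N(\<tau> E)\<close>.\<close>

definition twisted_op :: "complex \<Rightarrow> complex \<Rightarrow> nat \<Rightarrow> (nat \<Rightarrow> complex) \<Rightarrow> nat \<Rightarrow> complex" where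
  "twisted_op \<sigma> \<tau> N Y m = (\<Sum>i\<le>N. rec_coeff \<sigma> \<tau> N i * \<tau> ^ i * Y (m - i))"

lemma rec_coeff_0 [simp]: "rec_coeff \<sigma> \<tau> N 0 = 1"
  by (simp add: rec_coeff_def)

lemma triangular_Suc: "Suc k * (Suc k - 1) div 2 = k * (k - 1) div 2 + k"
proof -
  have "Suc k * (Suc k - 1) = k * (k - 1) + k * 2"
    by (cases k) (simp_all add: algebra_simps)
  then show ?thesis by simp
qed

lemma rec_coeff_Suc_Suc:
  assumes "k \<le> N"
  shows "rec_coeff \<sigma> \<tau> (Suc N) (Suc k)
    = \<tau> ^ Suc k * rec_coeff \<sigma> \<tau> N (Suc k) - \<sigma> ^ N * \<tau> ^ k * rec_coeff \<sigma> \<tau> N k"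
proof -
  have "\<sigma> ^ N = \<sigma> ^ k * \<sigma> ^ (N - k)"
    using assms by (simp add: power_add [symmetric])
  then show ?thesis
    unfolding rec_coeff_def triangular_Suc gen_binomial_Pascal [OF assms]
    by (simp add: power_add power_mult_distrib algebra_simps)
qed

lemma lucas_u_rec_coeff:
  "lucas_u \<sigma> \<tau> (Suc k) * rec_coeff \<sigma> \<tau> (Suc N) (Suc k)
    = - lucas_u \<sigma> \<tau> (Suc N) * (\<sigma> * \<tau>) ^ k * rec_coeff \<sigma> \<tau> N k"
proof -
  have "lucas_u \<sigma> \<tau> (Suc k) * rec_coeff \<sigma> \<tau> (Suc N) (Suc k)
      = (- 1) ^ Suc k * (\<sigma> * \<tau>) ^ (k * (k - 1) div 2 + k)
          * (lucas_u \<sigma> \<tau> (Suc k) * gen_binomial \<sigma> \<tau> (Suc N) (Suc k))"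
    unfolding rec_coeff_def triangular_Suc by (simp only: mult_ac)
  then show ?thesis
    unfolding gen_binomial_absorb rec_coeff_def by (simp add: power_add mult_ac)
qed

text \<open>The factorisation \<open>L\<^bsub>N+1\<^esub>(E) = (1 - \<sigma>\<^sup>N E) L\<^sub>N(\<tau> E)\<close>.\<close>

lemma shift_op_Suc:
  "shift_op \<sigma> \<tau> (Suc N) Y (Suc m) = twisted_op \<sigma> \<tau> N Y (Suc m) - \<sigma> ^ N * twisted_op \<sigma> \<tau> N Y m"
proof -
  let ?c = "rec_coeff \<sigma> \<tau> N"
  have top: "?c (Suc N) = 0"
    by (simp add: rec_coeff_def gen_binomial_eq_0)
  have "shift_op \<sigma> \<tau> (Suc N) Y (Suc m)
      = Y (Suc m) + (\<Sum>k\<le>N. rec_coeff \<sigma> \<tau> (Suc N) (Suc k) * Y (m - k))"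
    unfolding shift_op_def sum.atMost_Suc_shift by simp
  also have "(\<Sum>k\<le>N. rec_coeff \<sigma> \<tau> (Suc N) (Suc k) * Y (m - k))
      = (\<Sum>k\<le>N. ?c (Suc k) * \<tau> ^ Suc k * Y (m - k)) - \<sigma> ^ N * twisted_op \<sigma> \<tau> N Y m"
    unfolding twisted_op_def sum_distrib_left sum_subtractf [symmetric]
    by (intro sum.cong refl) (simp add: rec_coeff_Suc_Suc algebra_simps)
  also have "Y (Suc m) + (\<dots>)
      = (\<Sum>i\<le>Suc N. ?c i * \<tau> ^ i * Y (Suc m - i)) - \<sigma> ^ N * twisted_op \<sigma> \<tau> N Y m"
    unfolding sum.atMost_Suc_shift by simp
  also have "(\<Sum>i\<le>Suc N. ?c i * \<tau> ^ i * Y (Suc m - i)) = twisted_op \<sigma> \<tau> N Y (Suc m)"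
    by (simp add: twisted_op_def top)
  finally show ?thesis .
qed


section \<open>Multiplying by a solution of the recurrence\<close>

text \<open>
  Since \<open>z\<^bsub>r+1\<^esub> - \<tau> z\<^sub>r\<close> is multiplied by \<open>\<sigma>\<close> at each step, it equals \<open>\<sigma>\<^sup>r (z\<^sub>1 - \<tau> z\<^sub>0)\<close>; iterating this
  first-order recurrence \<open>i\<close> times gives the formula.
\<close>

lemma recurrence_expand:
  assumes "satisfies_recurrence (\<sigma> + \<tau>) (\<sigma> * \<tau>) z" and "i \<le> m"
  shows "z m = \<tau> ^ i * z (m - i) + (z 1 - \<tau> * z 0) * \<sigma> ^ (m - i) * lucas_u \<sigma> \<tau> i"
proof -
  have first_order: "z (Suc r) = \<tau> * z r + (z 1 - \<tau> * z 0) * \<sigma> ^ r" for r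
  proof (induction r)
    case (Suc r)
    have "z (Suc (Suc r)) = (\<sigma> + \<tau>) * z (Suc r) - \<sigma> * \<tau> * z r"
      using assms(1) by (simp add: satisfies_recurrence_def)
    also have "\<dots> = \<tau> * z (Suc r) + \<sigma> * (z (Suc r) - \<tau> * z r)"
      by (simp add: algebra_simps)
    also have "z (Suc r) - \<tau> * z r = (z 1 - \<tau> * z 0) * \<sigma> ^ r"
      using Suc.IH by simp
    finally show ?case by (simp add: mult_ac)
  qed simp
  have "z (r + i) = \<tau> ^ i * z r + (z 1 - \<tau> * z 0) * \<sigma> ^ r * lucas_u \<sigma> \<tau> i" for r
  proof (induction i arbitrary: r)
    case (Suc i)
    have "z (r + Suc i) = \<tau> ^ i * z (Suc r) + (z 1 - \<tau> * z 0) * \<sigma> ^ Suc r * lucas_u \<sigma> \<tau> i"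
      using Suc.IH [of "Suc r"] by simp
    then show ?case
      by (simp add: first_order [of r] lucas_u_Suc algebra_simps)
  qed simp
  from this [of "m - i"] show ?thesis using assms(2) by simp
qed

text \<open>
  The expansion of \<open>z m\<close> turns the twist \<open>\<tau>\<^sup>i\<close> into the untwisted operator times \<open>z m\<close>, at the price
  of a sum weighted by \<open>u\<^sub>i\<close>; absorbing \<open>u\<^sub>i\<close> into the binomial coefficient lowers \<open>N\<close> by one.
\<close>

lemma twisted_op_mult:
  assumes "satisfies_recurrence (\<sigma> + \<tau>) (\<sigma> * \<tau>) z" and "N \<le> m"
  shows "twisted_op \<sigma> \<tau> (Suc N) (\<lambda>m. z m * Y m) (Suc m)
    = z (Suc m) * shift_op \<sigma> \<tau> (Suc N) Y (Suc m)
      + (z 1 - \<tau> * z 0) * lucas_u \<sigma> \<tau> (Suc N) * \<sigma> ^ m * twisted_op \<sigma> \<tau> N Y m"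
proof -
  define d where "d = z 1 - \<tau> * z 0"
  let ?c = "rec_coeff \<sigma> \<tau> (Suc N)" and ?u = "lucas_u \<sigma> \<tau>"
  have "twisted_op \<sigma> \<tau> (Suc N) (\<lambda>m. z m * Y m) (Suc m)
      = (\<Sum>i\<le>Suc N. z (Suc m) * (?c i * Y (Suc m - i))
          - d * (?u i * ?c i * \<sigma> ^ (Suc m - i) * Y (Suc m - i)))"
    unfolding twisted_op_def
  proof (intro sum.cong refl)
    fix i assume "i \<in> {..Suc N}"
    then have "\<tau> ^ i * z (Suc m - i) = z (Suc m) - d * \<sigma> ^ (Suc m - i) * ?u i"
      using recurrence_expand [OF assms(1), of i "Suc m"] assms(2) by (simp add: d_def)
    then have "?c i * \<tau> ^ i * (z (Suc m - i) * Y (Suc m - i))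
        = ?c i * (z (Suc m) - d * \<sigma> ^ (Suc m - i) * ?u i) * Y (Suc m - i)"
      by (metis mult.assoc)
    then show "?c i * \<tau> ^ i * (z (Suc m - i) * Y (Suc m - i))
        = z (Suc m) * (?c i * Y (Suc m - i))
          - d * (?u i * ?c i * \<sigma> ^ (Suc m - i) * Y (Suc m - i))"
      by (simp only: algebra_simps)
  qed
  also have "\<dots> = z (Suc m) * shift_op \<sigma> \<tau> (Suc N) Y (Suc m)
      - d * (\<Sum>i\<le>Suc N. ?u i * ?c i * \<sigma> ^ (Suc m - i) * Y (Suc m - i))"
    by (simp only: shift_op_def sum_subtractf sum_distrib_left)
  also have "(\<Sum>i\<le>Suc N. ?u i * ?c i * \<sigma> ^ (Suc m - i) * Y (Suc m - i))
      = (\<Sum>k\<le>N. ?u (Suc k) * ?c (Suc k) * \<sigma> ^ (m - k) * Y (m - k))"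
    unfolding sum.atMost_Suc_shift by simp
  also have "\<dots> = - (?u (Suc N) * \<sigma> ^ m * twisted_op \<sigma> \<tau> N Y m)"
    unfolding twisted_op_def sum_distrib_left sum_negf [symmetric]
  proof (intro sum.cong refl)
    fix k assume "k \<in> {..N}"
    then have "\<sigma> ^ m = \<sigma> ^ k * \<sigma> ^ (m - k)"
      using assms(2) by (simp add: power_add [symmetric])
    then show "?u (Suc k) * ?c (Suc k) * \<sigma> ^ (m - k) * Y (m - k)
        = - (?u (Suc N) * \<sigma> ^ m * (rec_coeff \<sigma> \<tau> N k * \<tau> ^ k * Y (m - k)))"
      unfolding lucas_u_rec_coeff by (simp add: power_mult_distrib mult_ac)
  qed
  finally show ?thesis by (simp add: d_def mult.assoc)
qed

text \<open>
  Both remainders from \<open>twisted_op_mult\<close>, at \<open>m\<close> and \<open>m - 1\<close>, recombine by the factorisation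
  \<open>shift_op_Suc\<close> into a multiple of \<open>(L\<^bsub>N+1\<^esub>(E) Y) (m - 1)\<close>, which vanishes as well.
\<close>

lemma shift_op_mult_eq_0:
  assumes z: "satisfies_recurrence (\<sigma> + \<tau>) (\<sigma> * \<tau>) z"
    and Y: "\<And>m. Suc N \<le> m \<Longrightarrow> shift_op \<sigma> \<tau> (Suc N) Y m = 0"
    and m: "Suc (Suc N) \<le> m"
  shows "shift_op \<sigma> \<tau> (Suc (Suc N)) (\<lambda>m. z m * Y m) m = 0"
proof -
  obtain l where l: "m = Suc (Suc l)" "N \<le> l"
    using m by (metis Suc_le_D Suc_le_mono)
  let ?a = "(z 1 - \<tau> * z 0) * lucas_u \<sigma> \<tau> (Suc N)" and ?T = "twisted_op \<sigma> \<tau> N Y"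
  have "shift_op \<sigma> \<tau> (Suc (Suc N)) (\<lambda>m. z m * Y m) m
      = ?a * \<sigma> ^ Suc l * ?T (Suc l) - \<sigma> ^ Suc N * (?a * \<sigma> ^ l * ?T l)"
    unfolding l(1) shift_op_Suc using l(2) by (simp add: twisted_op_mult [OF z] Y)
  also have "\<dots> = ?a * \<sigma> ^ Suc l * (?T (Suc l) - \<sigma> ^ N * ?T l)"
    by (simp add: algebra_simps)
  also have "\<dots> = ?a * \<sigma> ^ Suc l * shift_op \<sigma> \<tau> (Suc N) Y (Suc l)"
    by (simp only: shift_op_Suc)
  also have "\<dots> = 0"
    using Y [of "Suc l"] l(2) by simp
  finally show ?thesis .
qed

lemma shift_op_prod_eq_0:
  assumes "\<And>j. j \<in> {1..n} \<Longrightarrow> satisfies_recurrence (\<sigma> + \<tau>) (\<sigma> * \<tau>) (x j)"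
    and "Suc n \<le> m"
  shows "shift_op \<sigma> \<tau> (Suc n) (\<lambda>m. \<Prod>j=1..n. x j m) m = 0"
  using assms
proof (induction n arbitrary: m)
  case 0
  \<comment> \<open>The empty product is the constant sequence \<open>1\<close>, and \<open>L\<^sub>1(E) = 1 - E\<close>.\<close>
  have "rec_coeff \<sigma> \<tau> 1 1 = - 1"
    using rec_coeff_Suc_Suc [of 0 0 \<sigma> \<tau>] by (simp add: rec_coeff_def gen_binomial_eq_0)
  then show ?case by (simp add: shift_op_def)
next
  case (Suc n)
  have "shift_op \<sigma> \<tau> (Suc (Suc n)) (\<lambda>m. x (Suc n) m * (\<Prod>j=1..n. x j m)) m = 0"
    by (rule shift_op_mult_eq_0) (use Suc in auto)
  then show ?case by (simp add: mult.commute)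
qed

theorem theorem2p2:
  fixes p q \<sigma> \<tau> :: complex
    and n :: nat
    and x :: "nat \<Rightarrow> nat \<Rightarrow> complex"
    and X :: "nat \<Rightarrow> complex"
  assumes roots: "[:q, - p, 1:] = [:- \<sigma>, 1:] * [:- \<tau>, 1:]"
    and n: "n \<ge> 1"
    and rec: "\<And>j. j \<in> {1..n} \<Longrightarrow> satisfies_recurrence p q (x j)"
    and X: "\<And>m. X m = (\<Prod>j=1..n. x j m)"
  shows "\<forall>m\<ge>n + 1.
    (\<Sum>i=0..n + 1. (- 1) ^ i * q ^ (i * (i - 1) div 2) * gen_binomial \<sigma> \<tau> (n + 1) i * X (m - i)) = 0"
proof (intro allI impI)
  fix m assume m: "n + 1 \<le> m"
  from roots have "- p = - \<sigma> - \<tau>" and q: "q = \<sigma> * \<tau>"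
    by simp_all
  then have p: "p = \<sigma> + \<tau>"
    by (simp add: algebra_simps minus_equation_iff [of p])
  have "shift_op \<sigma> \<tau> (Suc n) (\<lambda>m. \<Prod>j=1..n. x j m) m = 0"
    by (rule shift_op_prod_eq_0) (use rec m in \<open>simp_all add: p q\<close>)
  then show "(\<Sum>i=0..n + 1. (- 1) ^ i * q ^ (i * (i - 1) div 2) * gen_binomial \<sigma> \<tau> (n + 1) i
      * X (m - i)) = 0"
    by (simp add: shift_op_def rec_coeff_def X q atLeast0AtMost)
qed

end
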